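(* An edge-colored graph is a chromotopology of dimension $n$ if and only if it is isomorphic, as an edge-colored graph, to a quotient $I^n_c/L$ where $L\subseteq\mathbf{Z}_2^n$ is an even code containing no bitstring of weight $2$.
   Context: A code is a $\mathbf{Z}_2$-subspace $L\subseteq\mathbf{Z}_2^n$; the weight of a bitstring is its number of $1$'s, and $L$ is even if all its elements have even weight. With $e_i$ the $i$-th standard basis vector, $I^n_c/L$ is the edge-colored multigraph with vertex set $\mathbf{Z}_2^n/L$ having, for each coset $C$ and each color $i\in[n]$, an edge of color $i$ joining $C$ and $C+e_i$ (one per unordered pair and color; a loop if $e_i\in L$). A chromotopology of dimension $n$ is a finite connected simple bipartite graph in which every vertex has degree $n$, whose edges are colored by $[n]$ so that each vertex is incident to exactly one edge of each color, and such that for any distinct colors $i,j$ the edges of colors $i$ and $j$ form a disjoint union of $4$-cycles. *)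

theory Defs
  imports Complex_Main "HOL-Library.Z2" "HOL-Library.Function_Algebras"
begin

text \<open>
  Edge-colored multigraphs. Edges are objects of their own, so parallel edges are possible;
  \<open>ends e\<close> is the unordered pair of endpoints, a singleton when \<open>e\<close> is a loop.
\<close>

record ('v, 'e) cgraph =
  verts :: "'v set"
  edges :: "'e set"
  ends  :: "'e \<Rightarrow> 'v set"
  color :: "'e \<Rightarrow> nat"

definition edge_colored_graph :: "('v, 'e) cgraph \<Rightarrow> bool" where
  "edge_colored_graph G \<longleftrightarrow>
     (\<forall>e\<in>edges G. \<exists>u\<in>verts G. \<exists>v\<in>verts G. ends G e = {u, v})"

definition isomorphic :: "('v, 'e) cgraph \<Rightarrow> ('w, 'f) cgraph \<Rightarrow> bool" where
  "isomorphic G H \<longleftrightarrow>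
     (\<exists>f g. bij_betw f (verts G) (verts H) \<and> bij_betw g (edges G) (edges H) \<and>
       (\<forall>e\<in>edges G. ends H (g e) = f ` ends G e \<and> color H (g e) = color G e))"

definition finite_graph :: "('v, 'e) cgraph \<Rightarrow> bool" where
  "finite_graph G \<longleftrightarrow> finite (verts G) \<and> finite (edges G)"

text \<open>The graph without vertices does not count as connected.\<close>

definition connected_graph :: "('v, 'e) cgraph \<Rightarrow> bool" where
  "connected_graph G \<longleftrightarrow> verts G \<noteq> {} \<and>
     (\<forall>u\<in>verts G. \<forall>v\<in>verts G. (u, v) \<in> {(x, y). \<exists>e\<in>edges G. ends G e = {x, y}}\<^sup>*)"

definition simple_graph :: "('v, 'e) cgraph \<Rightarrow> bool" where
  "simple_graph G \<longleftrightarrow> (\<forall>e\<in>edges G. \<forall>v. ends G e \<noteq> {v}) \<and> inj_on (ends G) (edges G)"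

definition bipartite_graph :: "('v, 'e) cgraph \<Rightarrow> bool" where
  "bipartite_graph G \<longleftrightarrow>
     (\<exists>A B. A \<union> B = verts G \<and> A \<inter> B = {} \<and>
       (\<forall>e\<in>edges G. \<exists>a\<in>A. \<exists>b\<in>B. ends G e = {a, b}))"

text \<open>Loops contribute twice to the degree.\<close>

definition degree :: "('v, 'e) cgraph \<Rightarrow> 'v \<Rightarrow> nat" where
  "degree G v = card {e \<in> edges G. v \<in> ends G e} + card {e \<in> edges G. ends G e = {v}}"

definition four_cycle :: "('v, 'e) cgraph \<Rightarrow> 'e set \<Rightarrow> bool" where
  "four_cycle G F \<longleftrightarrow>
     (\<exists>a b c d e1 e2 e3 e4. distinct [a, b, c, d] \<and> F = {e1, e2, e3, e4} \<and> F \<subseteq> edges G \<and>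
       ends G e1 = {a, b} \<and> ends G e2 = {b, c} \<and> ends G e3 = {c, d} \<and> ends G e4 = {d, a})"

definition disjoint_union_of_four_cycles :: "('v, 'e) cgraph \<Rightarrow> 'e set \<Rightarrow> bool" where
  "disjoint_union_of_four_cycles G F \<longleftrightarrow>
     (\<exists>P. \<Union>P = F \<and> (\<forall>C\<in>P. four_cycle G C) \<and>
       (\<forall>C\<in>P. \<forall>D\<in>P. C \<noteq> D \<longrightarrow> \<Union>(ends G ` C) \<inter> \<Union>(ends G ` D) = {}))"

definition chromotopology :: "nat \<Rightarrow> ('v, 'e) cgraph \<Rightarrow> bool" where
  "chromotopology n G \<longleftrightarrow>
     edge_colored_graph G \<and> finite_graph G \<and> connected_graph G \<and>
     simple_graph G \<and> bipartite_graph G \<and>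
     (\<forall>v\<in>verts G. degree G v = n) \<and>
     color G ` edges G \<subseteq> {1..n} \<and>
     (\<forall>v\<in>verts G. \<forall>i\<in>{1..n}. \<exists>!e. e \<in> edges G \<and> v \<in> ends G e \<and> color G e = i) \<and>
     (\<forall>i\<in>{1..n}. \<forall>j\<in>{1..n}. i \<noteq> j \<longrightarrow>
       disjoint_union_of_four_cycles G {e \<in> edges G. color G e = i \<or> color G e = j})"

text \<open>
  The space of bitstrings of length \<open>n\<close> is realised as the functions \<open>nat \<Rightarrow> bit\<close>
  that vanish outside \<open>{1..n}\<close>.
\<close>

global_interpretation bits: vector_space "\<lambda>(c :: bit) (x :: nat \<Rightarrow> bit) i. c * x i"
  by unfold_locales (auto simp: fun_eq_iff algebra_simps)

definition bitstrings :: "nat \<Rightarrow> (nat \<Rightarrow> bit) set" where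
  "bitstrings n = {x. \<forall>i. i \<notin> {1..n} \<longrightarrow> x i = 0}"

definition std_basis :: "nat \<Rightarrow> nat \<Rightarrow> bit" where
  "std_basis i = (\<lambda>j. if j = i then 1 else 0)"

definition weight :: "(nat \<Rightarrow> bit) \<Rightarrow> nat" where
  "weight x = card {i. x i = 1}"

definition code :: "nat \<Rightarrow> (nat \<Rightarrow> bit) set \<Rightarrow> bool" where
  "code n L \<longleftrightarrow> L \<subseteq> bitstrings n \<and> bits.subspace L"

definition even_code :: "nat \<Rightarrow> (nat \<Rightarrow> bit) set \<Rightarrow> bool" where
  "even_code n L \<longleftrightarrow> code n L \<and> (\<forall>x\<in>L. even (weight x))"

definition cosets :: "nat \<Rightarrow> (nat \<Rightarrow> bit) set \<Rightarrow> (nat \<Rightarrow> bit) set set" where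
  "cosets n L = (\<lambda>x. (+) x ` L) ` bitstrings n"

definition translate :: "(nat \<Rightarrow> bit) set \<Rightarrow> (nat \<Rightarrow> bit) \<Rightarrow> (nat \<Rightarrow> bit) set" where
  "translate C y = (\<lambda>x. x + y) ` C"

text \<open>
  An edge of the quotient is a pair of the endpoint set \<open>{C, C + e\<^sub>i}\<close> and the color \<open>i\<close>;
  \<open>C\<close> and \<open>C + e\<^sub>i\<close> thus yield the same edge of color \<open>i\<close>, whereas different colors yield
  different, possibly parallel, edges.
\<close>

definition cube_quotient ::
  "nat \<Rightarrow> (nat \<Rightarrow> bit) set \<Rightarrow> ((nat \<Rightarrow> bit) set, (nat \<Rightarrow> bit) set set \<times> nat) cgraph" where
  "cube_quotient n L =
     \<lparr>verts = cosets n L,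
      edges = {({C, translate C (std_basis i)}, i) | C i. C \<in> cosets n L \<and> i \<in> {1..n}},
      ends = fst,
      color = snd\<rparr>"

lemma translate_in_cosets:
  assumes "C \<in> cosets n L" "y \<in> bitstrings n"
  shows "translate C y \<in> cosets n L"
proof -
  from assms(1) obtain x where x: "x \<in> bitstrings n" "C = (+) x ` L"
    by (auto simp: cosets_def)
  have "translate C y = (+) (x + y) ` L"
    by (simp add: translate_def x(2) image_image add_ac)
  moreover have "x + y \<in> bitstrings n"
    using x(1) assms(2) by (simp add: bitstrings_def)
  ultimately show ?thesis
    by (auto simp: cosets_def)
qed

lemma edge_colored_graph_cube_quotient: "edge_colored_graph (cube_quotient n L)"
proof -
  have "std_basis i \<in> bitstrings n" if "i \<in> {1..n}" for i
    using that by (auto simp: std_basis_def bitstrings_def)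
  then show ?thesis
    unfolding edge_colored_graph_def cube_quotient_def
    by (auto intro!: bexI translate_in_cosets)
qed

end

theory Submission
  imports Defs
begin

text \<open>
  In a chromotopology, moving along the edge of color \<open>i\<close> is an involution \<open>q i\<close> of the vertices,
  and the 4-cycle condition says that these involutions commute. They define an action of
  \<open>\<int>\<^sub>2\<^sup>n\<close>, transitive by connectedness, so the vertices are the cosets of the stabilizer \<open>L\<close> of a
  vertex. Bipartiteness makes \<open>L\<close> even, and simplicity excludes weight \<open>2\<close>. Conversely, adding
  \<open>e\<^sub>i\<close> gives commuting involutions on the cosets; evenness of \<open>L\<close> makes the weight parity of a
  coset well defined, which yields the bipartition.
\<close>

section \<open>Bitstrings\<close>

lemma bits_add_self [simp]: "x + x = (0 :: nat \<Rightarrow> bit)"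
  by (simp add: fun_eq_iff)

lemma bits_add_cancel [simp]: "x + (x + y) = (y :: nat \<Rightarrow> bit)"
  by (simp add: fun_eq_iff flip: add.assoc)

lemma zero_in_bitstrings [simp]: "0 \<in> bitstrings n"
  by (simp add: bitstrings_def)

lemma add_in_bitstrings: "x \<in> bitstrings n \<Longrightarrow> y \<in> bitstrings n \<Longrightarrow> x + y \<in> bitstrings n"
  by (simp add: bitstrings_def)

lemma std_basis_in_bitstrings: "i \<in> {1..n} \<Longrightarrow> std_basis i \<in> bitstrings n"
  by (auto simp: bitstrings_def std_basis_def)

text \<open>In characteristic 2, adding \<open>std_basis i\<close> to a bitstring with a 1 at
  \<open>i\<close> deletes that 1, so induction on the support applies. This reduces claims about
  the action of a bitstring to a single color.\<close>

lemma bitstrings_induct [consumes 1, case_names zero add]: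
  assumes "x \<in> bitstrings n"
    and "P 0"
    and step: "\<And>x i. x \<in> bitstrings n \<Longrightarrow> i \<in> {1..n} \<Longrightarrow> P x \<Longrightarrow> P (std_basis i + x)"
  shows "P x"
proof -
  have "P x" if "finite S" "{i. x i = 1} = S" "S \<subseteq> {1..n}" "x \<in> bitstrings n" for S
    using that
  proof (induction S arbitrary: x rule: finite_induct)
    case empty
    then have "x = 0" by (auto simp: fun_eq_iff)
    with \<open>P 0\<close> show ?case by (simp only:)
  next
    case (insert i S)
    let ?y = "std_basis i + x"
    have i: "i \<in> {1..n}" using insert.prems by auto
    have xi: "x i = 1" using insert.prems by auto
    have y: "?y \<in> bitstrings n"
      using insert.prems i by (simp add: add_in_bitstrings std_basis_in_bitstrings)
    have supp: "{j. ?y j = 1} = S"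
      using insert.prems(1) insert.hyps(2) xi
      by (auto simp: std_basis_def set_eq_iff split: if_splits)
    have "S \<subseteq> {1..n}" using insert.prems(2) by blast
    then have "P ?y" using insert.IH supp y by blast
    then have "P (std_basis i + ?y)" by (rule step[OF y i])
    then show ?case by (simp only: bits_add_cancel)
  qed
  moreover have "{i. x i = 1} \<subseteq> {1..n}"
    using assms(1) by (force simp: bitstrings_def)
  ultimately show ?thesis
    using assms(1) finite_subset by blast
qed

text \<open>A bitstring is determined by its support, a subset of \<open>{1..n}\<close>.\<close>

lemma finite_bitstrings: "finite (bitstrings n)"
proof (rule finite_imageD)
  show "finite ((\<lambda>x. {i. x i = 1}) ` bitstrings n)"
    by (rule finite_subset[of _ "Pow {1..n}"]) (force simp: bitstrings_def)+
  show "inj_on (\<lambda>x. {i. x i = (1 :: bit)}) (bitstrings n)"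
  proof (rule inj_onI, rule ext)
    fix x y :: "nat \<Rightarrow> bit" and i
    assume "{i. x i = 1} = {i. y i = 1}"
    then have "x i = 1 \<longleftrightarrow> y i = 1" by (auto simp: set_eq_iff)
    then show "x i = y i" by (metis (full_types) bit.exhaust)
  qed
qed

section \<open>Parity of the weight as a linear form\<close>

definition parity :: "nat \<Rightarrow> (nat \<Rightarrow> bit) \<Rightarrow> bit" where
  "parity n x = (\<Sum>i\<in>{1..n}. x i)"

lemma parity_zero [simp]: "parity n 0 = 0"
  by (simp add: parity_def)

lemma parity_add [simp]: "parity n (x + y) = parity n x + parity n y"
  unfolding parity_def plus_fun_apply by (rule sum.distrib)

lemma parity_std_basis [simp]: "i \<in> {1..n} \<Longrightarrow> parity n (std_basis i) = 1"
  by (simp add: parity_def std_basis_def)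

text \<open>All ones lie in \<open>{1..n}\<close>, so the sum over this range is the image of the
  weight in \<open>bit\<close>. Unlike \<open>weight\<close>, this residue is additive.\<close>

lemma even_weight_iff_parity:
  assumes "x \<in> bitstrings n"
  shows "even (weight x) \<longleftrightarrow> parity n x = 0"
proof -
  have "{i. x i = 1} = {i \<in> {1..n}. x i = 1}"
    using assms by (force simp: bitstrings_def)
  moreover have "parity n x = (\<Sum>i\<in>{i \<in> {1..n}. x i = 1}. 1)"
    unfolding parity_def by (subst sum.inter_filter) (auto intro!: sum.cong)
  ultimately have "parity n x = of_nat (weight x)"
    by (simp add: weight_def)
  moreover have "(of_nat k :: bit) = 0 \<longleftrightarrow> even k" for k
    by (induction k) auto
  ultimately show ?thesis
    by simp
qed

lemma weight_std_basis: "weight (std_basis i) = 1"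
proof -
  have "{j. std_basis i j = 1} = {i}" by (auto simp: std_basis_def)
  then show ?thesis by (simp add: weight_def)
qed

lemma weight_two_std_basis:
  assumes "i \<noteq> j"
  shows "weight (std_basis i + std_basis j) = 2"
proof -
  have "{k. (std_basis i + std_basis j) k = 1} = {i, j}"
    using assms by (auto simp: std_basis_def)
  then show ?thesis using assms by (simp add: weight_def)
qed

text \<open>Turns a forbidden codeword into two colors; the values at \<open>i\<close> and
  \<open>j\<close> later place both colors in \<open>{1..n}\<close>.\<close>

lemma weight_two_cases:
  assumes "weight x = 2"
  obtains i j where "i \<noteq> j" "x = std_basis i + std_basis j" "x i = 1" "x j = 1"
proof -
  from assms obtain i j where ij: "{k. x k = 1} = {i, j}" "i \<noteq> j"
    by (auto simp: weight_def card_2_iff)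
  have "x k = (std_basis i + std_basis j) k" for k
  proof -
    have "x k = 1 \<longleftrightarrow> (std_basis i + std_basis j) k = 1"
      using ij by (auto simp: std_basis_def set_eq_iff)
    then show ?thesis by (metis (full_types) bit.exhaust)
  qed
  then have "x = std_basis i + std_basis j" by (rule ext)
  moreover have "x i = 1" "x j = 1" using ij(1) by auto
  ultimately show thesis by (rule that[OF ij(2)])
qed

section \<open>Codes and cosets\<close>

lemma code_add: "code n L \<Longrightarrow> x \<in> L \<Longrightarrow> y \<in> L \<Longrightarrow> x + y \<in> L"
  by (simp add: code_def bits.subspace_add)

lemma code_zero: "code n L \<Longrightarrow> 0 \<in> L"
  by (simp add: code_def bits.subspace_0)

text \<open>The only scalars are 0 and 1, so closure under scaling amounts to containing 0.\<close>

lemma codeI: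
  assumes "L \<subseteq> bitstrings n" "0 \<in> L" "\<And>x y. x \<in> L \<Longrightarrow> y \<in> L \<Longrightarrow> x + y \<in> L"
  shows "code n L"
proof -
  have "(\<lambda>i. c * x i) \<in> L" if "x \<in> L" for c :: bit and x
  proof (cases c)
    case zero
    then show ?thesis using assms(2) by (simp add: zero_fun_def)
  next
    case one
    then show ?thesis using that by (simp only: mult_1_left)
  qed
  then show ?thesis
    using assms unfolding code_def bits.subspace_def by blast
qed

lemma in_coset_iff: "y \<in> (+) x ` L \<longleftrightarrow> x + y \<in> (L :: (nat \<Rightarrow> bit) set)"
  by (metis bits_add_cancel image_iff)

lemma coset_eq_iff:
  assumes "code n L"
  shows "(+) x ` L = (+) y ` L \<longleftrightarrow> x + y \<in> L"
proof
  assume "(+) x ` L = (+) y ` L"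
  moreover have "y \<in> (+) y ` L" using code_zero[OF assms] by (simp add: in_coset_iff)
  ultimately show "x + y \<in> L" by (simp flip: in_coset_iff)
next
  assume xy: "x + y \<in> L"
  \<comment> \<open>Adding the codeword \<open>x + y\<close> exchanges \<open>x + z\<close> and
    \<open>y + z\<close>.\<close>
  have "x + z \<in> L \<longleftrightarrow> y + z \<in> L" for z
  proof -
    have "(x + y) + (x + z) = y + z" "(x + y) + (y + z) = x + z"
      by (simp_all add: ac_simps)
    then show ?thesis using code_add[OF assms xy] by metis
  qed
  then show "(+) x ` L = (+) y ` L" by (auto simp: set_eq_iff in_coset_iff)
qed

lemma translate_coset: "translate ((+) x ` L) y = (+) (y + x) ` L"
  by (simp add: translate_def image_image add_ac)

lemma translate_translate: "translate (translate C x) y = translate C (x + y)"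
  by (simp add: translate_def image_image add_ac)

lemma translate_zero [simp]: "translate C 0 = C"
  by (simp add: translate_def)

text \<open>The representative of \<open>C\<close> occurs twice in the difference and cancels. Hence
  loops and parallel edges in the quotient come from codewords of weight 1 and 2.\<close>

lemma translate_eq_translate_iff:
  assumes "code n L" "C \<in> cosets n L"
  shows "translate C y = translate C z \<longleftrightarrow> y + z \<in> L"
proof -
  obtain x where C: "C = (+) x ` L" using assms(2) by (auto simp: cosets_def)
  have "(y + x) + (z + x) = y + z" by (simp add: fun_eq_iff algebra_simps)
  then show ?thesis
    by (simp add: C translate_coset coset_eq_iff[OF assms(1)])
qed

text \<open>
  Induction yields eta-expanded bitstrings; under the binder these two rules would unfold sums
  of bitstrings, and lemmas about \<open>x + y\<close> would no longer match.
\<close>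

declare plus_fun_apply [simp del] zero_fun_apply [simp del]

section \<open>Graphs given by commuting involutions\<close>

text \<open>Common ground of both directions: \<open>q i\<close> follows the edge of color
  \<open>i\<close> in a chromotopology and adds \<open>std_basis i\<close> in a quotient. By
  \<open>edges_bij\<close>, edges amount to pairs of endpoint set and color, the form they have in
  \<open>cube_quotient\<close>.\<close>

locale involution_graph =
  fixes n :: nat and G :: "('v, 'e) cgraph" and q :: "nat \<Rightarrow> 'v \<Rightarrow> 'v"
  assumes q_closed: "\<And>i v. i \<in> {1..n} \<Longrightarrow> v \<in> verts G \<Longrightarrow> q i v \<in> verts G"
    and q_q: "\<And>i v. i \<in> {1..n} \<Longrightarrow> v \<in> verts G \<Longrightarrow> q i (q i v) = v"
    and q_commute: "\<And>i j v. i \<in> {1..n} \<Longrightarrow> j \<in> {1..n} \<Longrightarrow> v \<in> verts G \<Longrightarrow> q i (q j v) = q j (q i v)"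
    and q_neq: "\<And>i v. i \<in> {1..n} \<Longrightarrow> v \<in> verts G \<Longrightarrow> q i v \<noteq> v"
    and q_distinct: "\<And>i j v. i \<in> {1..n} \<Longrightarrow> j \<in> {1..n} \<Longrightarrow> i \<noteq> j \<Longrightarrow> v \<in> verts G \<Longrightarrow> q i v \<noteq> q j v"
    and edges_bij: "bij_betw (\<lambda>e. (ends G e, color G e)) (edges G)
                      {({v, q i v}, i) | v i. v \<in> verts G \<and> i \<in> {1..n}}"
begin

section \<open>Edges described by an endpoint and a color\<close>

lemma edge_cases:
  assumes "e \<in> edges G"
  obtains v where "v \<in> verts G" "color G e \<in> {1..n}" "ends G e = {v, q (color G e) v}"
proof -
  have "(ends G e, color G e) \<in> {({v, q i v}, i) | v i. v \<in> verts G \<and> i \<in> {1..n}}"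
    using bij_betwE[OF edges_bij] assms by blast
  then show thesis using that by auto
qed

text \<open>As \<open>q i\<close> is an involution, either endpoint can serve as the base point of
  the edge.\<close>

lemma edge_at:
  assumes "e \<in> edges G" "v \<in> ends G e"
  shows "v \<in> verts G" "color G e \<in> {1..n}" "ends G e = {v, q (color G e) v}"
proof -
  obtain w where w: "w \<in> verts G" "color G e \<in> {1..n}" "ends G e = {w, q (color G e) w}"
    using assms(1) by (rule edge_cases)
  then consider "v = w" | "v = q (color G e) w" using assms(2) by auto
  then have "v \<in> verts G \<and> ends G e = {v, q (color G e) v}"
    by cases (use w q_closed[OF w(2,1)] q_q[OF w(2,1)] in \<open>metis insert_commute\<close>)+
  then show "v \<in> verts G" "color G e \<in> {1..n}" "ends G e = {v, q (color G e) v}"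
    using w(2) by blast+
qed

lemma edge_eqI:
  assumes "e \<in> edges G" "e' \<in> edges G" "ends G e = ends G e'" "color G e = color G e'"
  shows "e = e'"
  using bij_betw_imp_inj_on[OF edges_bij] assms by (auto dest: inj_onD)

definition edge :: "'v \<Rightarrow> nat \<Rightarrow> 'e" where
  "edge v i = (SOME e. e \<in> edges G \<and> ends G e = {v, q i v} \<and> color G e = i)"

lemma edge:
  assumes "v \<in> verts G" "i \<in> {1..n}"
  shows "edge v i \<in> edges G" "ends G (edge v i) = {v, q i v}" "color G (edge v i) = i"
proof -
  have "({v, q i v}, i) \<in> (\<lambda>e. (ends G e, color G e)) ` edges G"
    using bij_betw_imp_surj_on[OF edges_bij] assms by blast
  then have "\<exists>e. e \<in> edges G \<and> ends G e = {v, q i v} \<and> color G e = i" by auto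
  from someI_ex[OF this] show "edge v i \<in> edges G" "ends G (edge v i) = {v, q i v}" "color G (edge v i) = i"
    by (simp_all add: edge_def)
qed

text \<open>One endpoint and the color fix the other endpoint, and endpoints with color fix the
  edge.\<close>

lemma edge_eq_iff:
  assumes "v \<in> verts G" "i \<in> {1..n}"
  shows "e = edge v i \<longleftrightarrow> e \<in> edges G \<and> v \<in> ends G e \<and> color G e = i"
  using edge[OF assms] edge_at[of e v] edge_eqI[of e "edge v i"] by auto

lemma edge_q:
  assumes "v \<in> verts G" "i \<in> {1..n}"
  shows "edge (q i v) i = edge v i"
  using edge[OF assms] edge_eq_iff[of "q i v" i "edge v i"] assms q_closed by auto

lemma ex1_edge:
  assumes "v \<in> verts G" "i \<in> {1..n}"
  shows "\<exists>!e. e \<in> edges G \<and> v \<in> ends G e \<and> color G e = i"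
  using edge_eq_iff[OF assms] by metis

section \<open>The axioms of a chromotopology\<close>

lemma simple_graph: "simple_graph G"
  unfolding simple_graph_def
proof (intro conjI ballI allI inj_onI)
  fix e v assume "e \<in> edges G"
  then show "ends G e \<noteq> {v}"
    by (auto elim!: edge_cases dest: q_neq)
next
  fix e e' assume e: "e \<in> edges G" "e' \<in> edges G" "ends G e = ends G e'"
  obtain v where v: "v \<in> ends G e" using e(1) by (auto elim: edge_cases)
  note at = edge_at[OF e(1) v] edge_at[OF e(2) v[unfolded e(3)]]
  \<comment> \<open>Two edges with the same ends lead from \<open>v\<close> to the same neighbor,
    and distinct colors have distinct neighbors.\<close>
  then have "q (color G e) v = q (color G e') v"
    using e(3) q_neq by (auto simp: doubleton_eq_iff)
  then have "color G e = color G e'" using at q_distinct by blast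
  then show "e = e'" using e edge_eqI by blast
qed

text \<open>The loop term vanishes by simplicity, and coloring is a bijection from the edges at
  \<open>v\<close> onto \<open>{1..n}\<close>.\<close>

lemma degree: "v \<in> verts G \<Longrightarrow> degree G v = n"
proof -
  assume v: "v \<in> verts G"
  have "card {e \<in> edges G. ends G e = {v}} = 0"
    using simple_graph by (auto simp: simple_graph_def intro!: card_eq_0_iff[THEN iffD2])
  moreover have "bij_betw (color G) {e \<in> edges G. v \<in> ends G e} {1..n}"
    unfolding bij_betw_def
  proof
    show "inj_on (color G) {e \<in> edges G. v \<in> ends G e}"
    proof (rule inj_onI)
      fix e e' assume "e \<in> {e \<in> edges G. v \<in> ends G e}" "e' \<in> {e \<in> edges G. v \<in> ends G e}"
        "color G e = color G e'"
      then show "e = e'" using ex1_edge[OF v edge_at(2)[of e v]] by auto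
    qed
    show "color G ` {e \<in> edges G. v \<in> ends G e} = {1..n}"
    proof (intro equalityI subsetI)
      fix i assume "i \<in> {1..n}"
      from edge[OF v this] show "i \<in> color G ` {e \<in> edges G. v \<in> ends G e}" by (intro image_eqI) auto
    qed (use edge_at(2) in blast)
  qed
  ultimately show ?thesis
    by (simp add: degree_def bij_betw_same_card)
qed

text \<open>The orbit of a vertex \<open>v\<close> under the involutions of the colors
  \<open>i\<close> and \<open>j\<close>; for \<open>i \<noteq> j\<close> it is the vertex set of a
  4-cycle.\<close>

definition square :: "nat \<Rightarrow> nat \<Rightarrow> 'v \<Rightarrow> 'v set" where
  "square i j v = {v, q i v, q j v, q i (q j v)}"

lemma square_eq:
  assumes "i \<in> {1..n}" "j \<in> {1..n}" "v \<in> verts G" "w \<in> square i j v"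
  shows "square i j w = square i j v"
  using assms by (auto simp: square_def q_q q_closed q_commute[of j i])

lemma disjoint_union_of_four_cycles:
  assumes i: "i \<in> {1..n}" and j: "j \<in> {1..n}" and "i \<noteq> j"
  shows "disjoint_union_of_four_cycles G {e \<in> edges G. color G e = i \<or> color G e = j}"
proof -
  \<comment> \<open>The edges of colors \<open>i\<close> and \<open>j\<close> around the square with
    corners \<open>v\<close>, \<open>q i v\<close>, \<open>q i (q j v)\<close>,
    \<open>q j v\<close>.\<close>
  define cyc where "cyc v = {edge v i, edge (q i v) j, edge (q j v) i, edge v j}" for v
  note qc = q_closed[OF i] q_closed[OF j] q_q[OF i] q_q[OF j] q_commute[OF j i]
  note edge_i = edge[OF _ i] and edge_j = edge[OF _ j]
  have ends_cyc: "\<Union>(ends G ` cyc v) = square i j v" if v: "v \<in> verts G" for v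
    using v by (auto simp: cyc_def square_def edge_i edge_j qc)
  \<comment> \<open>This describes \<open>cyc v\<close> by the orbit alone, so vertices with the
    same square give the same cycle.\<close>
  have cyc_iff: "e \<in> cyc v \<longleftrightarrow>
      e \<in> edges G \<and> (color G e = i \<or> color G e = j) \<and> ends G e \<subseteq> square i j v" (is "_ = ?R")
    if v: "v \<in> verts G" for e v
  proof
    assume e: "e \<in> cyc v"
    then have "ends G e \<subseteq> square i j v" using ends_cyc[OF v] by blast
    moreover have "e \<in> edges G \<and> (color G e = i \<or> color G e = j)"
      using e v by (auto simp: cyc_def edge_i edge_j qc)
    ultimately show ?R by blast
  next
    assume R: ?R
    then obtain w where w: "w \<in> ends G e" using edge_cases by blast
    with R have "w \<in> square i j v" "w \<in> verts G" using edge_at by auto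
    moreover have "e = edge w i \<or> e = edge w j"
      using R w \<open>w \<in> verts G\<close> edge_eq_iff i j by auto
    ultimately show "e \<in> cyc v"
      using v edge_q[OF _ i, of v] edge_q[OF _ j, of v] edge_q[OF _ i, of "q j v"] edge_q[OF _ j, of "q i v"]
      by (auto simp: square_def cyc_def qc)
  qed
  have four: "four_cycle G (cyc v)" if v: "v \<in> verts G" for v
    unfolding four_cycle_def
  proof (intro exI conjI)
    show "cyc v = {edge v i, edge (q i v) j, edge (q j v) i, edge v j}" by (simp add: cyc_def)
    show "cyc v \<subseteq> edges G" using cyc_iff[OF v] by blast
    \<comment> \<open>If opposite corners coincided, applying \<open>q i\<close> would give
      \<open>q j v = q i v\<close>.\<close>
    have "q i (q j v) \<noteq> v" using v i j \<open>i \<noteq> j\<close> by (metis q_distinct q_q q_closed)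
    moreover have "q i v \<noteq> q i (q j v)" using v i j by (metis q_neq q_q q_closed)
    ultimately show "distinct [v, q i v, q i (q j v), q j v]"
      using v i j \<open>i \<noteq> j\<close> q_neq[of i v] q_neq[of j v] q_neq[of i "q j v"] q_distinct[of i j v]
      by (auto simp: qc)
  qed (use v in \<open>auto simp: edge_i edge_j qc\<close>)
  show ?thesis
    unfolding disjoint_union_of_four_cycles_def
  proof (intro exI[of _ "cyc ` verts G"] conjI ballI impI)
    show "\<Union>(cyc ` verts G) = {e \<in> edges G. color G e = i \<or> color G e = j}"
    proof (intro equalityI subsetI)
      fix e assume "e \<in> {e \<in> edges G. color G e = i \<or> color G e = j}"
      then have e: "e \<in> edges G" "color G e = i \<or> color G e = j" by auto
      then obtain v where v: "v \<in> verts G" "ends G e = {v, q (color G e) v}" 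
        by (auto elim: edge_cases)
      then have "e \<in> cyc v" using e v by (auto simp: cyc_iff square_def)
      then show "e \<in> \<Union>(cyc ` verts G)" using v by blast
    qed (auto simp: cyc_iff)
    show "four_cycle G C" if "C \<in> cyc ` verts G" for C using that four by auto
    fix C D assume "C \<in> cyc ` verts G" "D \<in> cyc ` verts G" and neq: "C \<noteq> D"
    then obtain v w where vw: "v \<in> verts G" "w \<in> verts G" "C = cyc v" "D = cyc w" by auto
    \<comment> \<open>Distinct cycles have distinct squares, and two orbits that meet are
      equal.\<close>
    have "square i j v \<noteq> square i j w"
      using neq vw by (auto simp: set_eq_iff cyc_iff)
    then have "square i j v \<inter> square i j w = {}"
      using square_eq[OF i j] vw by blast
    then show "\<Union>(ends G ` C) \<inter> \<Union>(ends G ` D) = {}"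
      using ends_cyc vw by simp
  qed
qed

text \<open>The local conditions come from the involutions, which leaves the global ones. Finitely
  many edges follow because simplicity makes an edge determined by its endpoint set.\<close>

lemma chromotopologyI:
  assumes "finite (verts G)" "connected_graph G" "bipartite_graph G"
  shows "chromotopology n G"
proof -
  have ecg: "edge_colored_graph G"
    unfolding edge_colored_graph_def by (meson edge_cases q_closed)
  have "finite (edges G)"
  proof (rule finite_imageD)
    show "inj_on (ends G) (edges G)" using simple_graph by (simp add: simple_graph_def)
    show "finite (ends G ` edges G)"
      by (rule finite_subset[of _ "Pow (verts G)"]) (use assms(1) edge_at in auto)
  qed
  then show ?thesis
    using ecg assms simple_graph degree ex1_edge disjoint_union_of_four_cycles
    unfolding chromotopology_def finite_graph_def
    by (auto elim: edge_cases)
qed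

section \<open>The action of bitstrings\<close>

text \<open>Composes the \<open>q k\<close> with \<open>x k = 1\<close> in increasing order of
  \<open>k\<close>. The recursion fixes an order, which commutation makes immaterial on
  vertices.\<close>

fun act_upto :: "nat \<Rightarrow> (nat \<Rightarrow> bit) \<Rightarrow> 'v \<Rightarrow> 'v" where
  "act_upto 0 x v = v"
| "act_upto (Suc k) x v = (if x (Suc k) = 1 then q (Suc k) (act_upto k x v) else act_upto k x v)"

definition act :: "(nat \<Rightarrow> bit) \<Rightarrow> 'v \<Rightarrow> 'v" where
  "act = act_upto n"

lemma act_upto_closed: "k \<le> n \<Longrightarrow> v \<in> verts G \<Longrightarrow> act_upto k x v \<in> verts G"
  by (induction k) (auto simp: q_closed)

text \<open>At stage \<open>i\<close> the involution is either inserted or cancels against itself;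
  at later stages it moves outward by commutation. Before stage \<open>i\<close> the changed
  coordinate has not been read.\<close>

lemma act_upto_add_std_basis:
  assumes "k \<le> n" "v \<in> verts G" "i \<in> {1..n}"
  shows "act_upto k (std_basis i + x) v =
    (if i \<le> k then q i (act_upto k x v) else act_upto k x v)"
  using assms(1)
proof (induction k)
  case 0
  then show ?case using assms(3) by simp
next
  case (Suc k)
  then have IH: "act_upto k (std_basis i + x) v = (if i \<le> k then q i (act_upto k x v) else act_upto k x v)"
    by simp
  have V: "act_upto k x v \<in> verts G" using Suc.prems assms(2) act_upto_closed by simp
  have Sk: "Suc k \<in> {1..n}" using Suc.prems by simp
  show ?case
  proof (cases "i = Suc k")
    case True
    then have "(std_basis i + x) (Suc k) = 1 + x (Suc k)"
      by (simp add: std_basis_def plus_fun_apply)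
    then show ?thesis using True IH V q_q[OF Sk V] by (cases "x (Suc k)") auto
  next
    case False
    then have "i \<le> Suc k \<longleftrightarrow> i \<le> k" "(std_basis i + x) (Suc k) = x (Suc k)"
      by (auto simp: std_basis_def plus_fun_apply)
    then show ?thesis using IH V Sk assms(3) q_commute[of i "Suc k"] by auto
  qed
qed

lemma act_closed: "v \<in> verts G \<Longrightarrow> act x v \<in> verts G"
  by (simp add: act_def act_upto_closed)

lemma act_zero [simp]: "act 0 v = v"
proof -
  have "act_upto k 0 v = v" for k by (induction k) (auto simp: zero_fun_apply)
  then show ?thesis by (simp add: act_def)
qed

lemma act_add_std_basis:
  "v \<in> verts G \<Longrightarrow> i \<in> {1..n} \<Longrightarrow> act (std_basis i + x) v = q i (act x v)"
  by (simp add: act_def act_upto_add_std_basis)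

lemma act_std_basis: "v \<in> verts G \<Longrightarrow> i \<in> {1..n} \<Longrightarrow> act (std_basis i) v = q i v"
  using act_add_std_basis[of v i 0] by simp

text \<open>Peeling basis vectors off \<open>x\<close> one by one shows that \<open>act\<close> is a
  group action.\<close>

lemma act_add:
  assumes "x \<in> bitstrings n" "v \<in> verts G"
  shows "act (x + y) v = act x (act y v)"
  using assms(1)
proof (induction rule: bitstrings_induct)
  case (add x i)
  then show ?case using assms(2)
    by (simp add: act_add_std_basis act_closed add.assoc)
qed simp

text \<open>Every bitstring acts as an involution, so applying \<open>y\<close> to both sides moves
  it across. Thus the fibers of the orbit map are cosets of the stabilizer.\<close>

lemma act_eq_act_iff:
  assumes "x \<in> bitstrings n" "y \<in> bitstrings n" "v \<in> verts G"
  shows "act x v = act y v \<longleftrightarrow> act (x + y) v = v"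
proof
  assume "act x v = act y v"
  then have "act (x + y) v = act (y + y) v"
    using assms by (metis act_add add.commute)
  then show "act (x + y) v = v" by simp
next
  assume "act (x + y) v = v"
  then have "act (y + (x + y)) v = act y v"
    using act_add[OF assms(2,3)] by metis
  moreover have "y + (x + y) = x" by (simp only: add.left_commute[of y x] bits_add_self add_0_right)
  ultimately show "act x v = act y v" by simp
qed

text \<open>Summing the basis vectors of the colors along a walk from \<open>v\<close> to
  \<open>w\<close> gives a bitstring that carries \<open>v\<close> to \<open>w\<close>.\<close>

lemma act_surj:
  assumes "connected_graph G" "v \<in> verts G" "w \<in> verts G"
  shows "\<exists>x\<in>bitstrings n. act x v = w"
proof -
  have "(v, w) \<in> {(x, y). \<exists>e\<in>edges G. ends G e = {x, y}}\<^sup>*"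
    using assms by (auto simp: connected_graph_def)
  then show ?thesis
  proof (induction rule: rtrancl_induct)
    case base
    then show ?case by (intro bexI[of _ 0]) auto
  next
    case (step u w)
    then obtain e x where e: "e \<in> edges G" "ends G e = {u, w}" and x: "x \<in> bitstrings n" "act x v = u"
      by auto
    have at: "u \<in> verts G" "color G e \<in> {1..n}" "ends G e = {u, q (color G e) u}"
      using edge_at[of e u] e by auto
    then have "w = q (color G e) u"
      using e by (auto simp: doubleton_eq_iff)
    then have "act (std_basis (color G e) + x) v = w"
      using x assms(2) at(2) by (simp add: act_add_std_basis)
    then show ?case using x at(2) add_in_bitstrings std_basis_in_bitstrings by blast
  qed
qed

text \<open>Each \<open>q i\<close> switches sides, and adding \<open>std_basis i\<close> flips the
  parity.\<close>

lemma act_bipartition: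
  assumes AB: "A \<union> B = verts G" "A \<inter> B = {}" "\<forall>e\<in>edges G. \<exists>a\<in>A. \<exists>b\<in>B. ends G e = {a, b}"
    and "v \<in> A" "x \<in> bitstrings n"
  shows "act x v \<in> A \<longleftrightarrow> parity n x = 0"
  using assms(5)
proof (induction rule: bitstrings_induct)
  case (add x i)
  have v: "v \<in> verts G" using assms by auto
  let ?u = "act x v"
  have u: "?u \<in> verts G" using v by (rule act_closed)
  have "\<exists>a\<in>A. \<exists>b\<in>B. {?u, q i ?u} = {a, b}"
    using edge[OF u add(2)] AB(3) by metis
  then have "q i ?u \<in> A \<longleftrightarrow> ?u \<notin> A"
    using AB(2) by (auto simp: doubleton_eq_iff)
  then show ?case using add v by (cases "parity n x") (auto simp: act_add_std_basis)
qed (use assms in simp)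

section \<open>Identification with a quotient of the cube\<close>

lemma isomorphic_cube_quotientI:
  assumes f: "bij_betw f (verts G) (cosets n L)"
    and f_q: "\<And>i v. i \<in> {1..n} \<Longrightarrow> v \<in> verts G \<Longrightarrow> f (q i v) = translate (f v) (std_basis i)"
  shows "isomorphic G (cube_quotient n L)"
proof -
  let ?E = "{({v, q i v}, i) | v i. v \<in> verts G \<and> i \<in> {1..n}}"
  \<comment> \<open>Edges on both sides are encoded by endpoint set and color, so the vertex
    bijection \<open>f\<close> induces the edge bijection.\<close>
  let ?h = "\<lambda>(S, i :: nat). (f ` S, i)"
  have "bij_betw ?h ?E (edges (cube_quotient n L))"
    unfolding bij_betw_def
  proof
    have "?E \<subseteq> Pow (verts G) \<times> UNIV" using q_closed by auto
    moreover have "inj_on ?h (Pow (verts G) \<times> UNIV)"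
      using inj_on_image_Pow[OF bij_betw_imp_inj_on[OF f]]
      by (auto simp: inj_on_def)
    ultimately show "inj_on ?h ?E" by (rule inj_on_subset[rotated])
    have "?h ` ?E = {({f v, translate (f v) (std_basis i)}, i) | v i. v \<in> verts G \<and> i \<in> {1..n}}"
    proof -
      have *: "({f v, translate (f v) (std_basis i)}, i) = ?h ({v, q i v}, i)"
        if "v \<in> verts G" "i \<in> {1..n}" for v i
        using f_q that by simp
      have "?h ` ?E = {?h ({v, q i v}, i) | v i. v \<in> verts G \<and> i \<in> {1..n}}" by blast
      also have "\<dots> = {({f v, translate (f v) (std_basis i)}, i) | v i. v \<in> verts G \<and> i \<in> {1..n}}"
        by (intro Collect_cong ex_cong1) (metis *)
      finally show ?thesis .
    qed
    then show "?h ` ?E = edges (cube_quotient n L)"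
      by (auto simp: cube_quotient_def simp flip: bij_betw_imp_surj_on[OF f])
  qed
  from bij_betw_trans[OF edges_bij this]
  have "bij_betw (\<lambda>e. (f ` ends G e, color G e)) (edges G) (edges (cube_quotient n L))"
    by (simp add: comp_def)
  then show ?thesis
    unfolding isomorphic_def using f
    by (intro exI[of _ f] exI[of _ "\<lambda>e. (f ` ends G e, color G e)"])
      (simp add: cube_quotient_def)
qed

text \<open>This is the orbit-stabilizer correspondence for a base vertex \<open>u\<close>: vertices
  match the cosets of its stabilizer.\<close>

lemma isomorphic_cube_quotient:
  assumes "connected_graph G" "bipartite_graph G"
  obtains L where "even_code n L" "\<forall>x\<in>L. weight x \<noteq> 2" "isomorphic G (cube_quotient n L)"
proof -
  obtain A B where AB: "A \<union> B = verts G" "A \<inter> B = {}"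
    "\<forall>e\<in>edges G. \<exists>a\<in>A. \<exists>b\<in>B. ends G e = {a, b}"
    using assms(2) by (auto simp: bipartite_graph_def)
  obtain u where u: "u \<in> verts G" using assms(1) by (auto simp: connected_graph_def)
  \<comment> \<open>The two sides are swapped if necessary, so that the base vertex lies in
    \<open>A\<close>.\<close>
  then obtain A B where AB: "A \<union> B = verts G" "A \<inter> B = {}"
    "\<forall>e\<in>edges G. \<exists>a\<in>A. \<exists>b\<in>B. ends G e = {a, b}" and uA: "u \<in> A"
  proof (cases "u \<in> A")
    case False
    have "\<forall>e\<in>edges G. \<exists>a\<in>B. \<exists>b\<in>A. ends G e = {a, b}"
      using AB(3) by (metis insert_commute)
    then show ?thesis using that[of B A] AB u False by auto
  qed (use that AB in auto)
  \<comment> \<open>The stabilizer of \<open>u\<close>: its words close up at \<open>u\<close>, so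
    they preserve the side of the bipartition and have even weight.\<close>
  define L where "L = {x \<in> bitstrings n. act x u = u}"
  have code: "code n L"
    by (rule codeI) (auto simp: L_def add_in_bitstrings act_add u)
  have "even (weight x)" if "x \<in> L" for x
    using that act_bipartition[OF AB uA, of x] even_weight_iff_parity uA by (auto simp: L_def)
  then have 1: "even_code n L" using code by (simp add: even_code_def)
  have 2: "\<forall>x\<in>L. weight x \<noteq> 2"
  proof (intro ballI notI)
    fix x assume x: "x \<in> L" and "weight x = 2"
    then obtain i j where ij: "i \<noteq> j" "x = std_basis i + std_basis j" "x i = 1" "x j = 1"
      by (auto elim: weight_two_cases)
    have ij': "i \<in> {1..n}" "j \<in> {1..n}"
      using x ij(3,4) by (force simp: L_def bitstrings_def)+
    \<comment> \<open>A codeword of weight 2 would make two colors lead from \<open>u\<close> to the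
      same neighbor.\<close>
    have "act (std_basis i) u = act (std_basis j) u"
      using x ij(2) ij' u act_eq_act_iff std_basis_in_bitstrings by (simp add: L_def)
    then show False using act_std_basis ij' u q_distinct[OF ij' ij(1) u] by simp
  qed
  \<comment> \<open>All bitstrings carrying \<open>u\<close> to \<open>v\<close>; by transitivity
    this set is a coset of the stabilizer.\<close>
  define f where "f v = {x \<in> bitstrings n. act x u = v}" for v
  have f_act: "f (act x u) = (+) x ` L" if "x \<in> bitstrings n" for x
  proof -
    have "y \<in> f (act x u) \<longleftrightarrow> x + y \<in> L" for y
    proof -
      have "y \<in> bitstrings n \<longleftrightarrow> x + y \<in> bitstrings n"
        by (metis add_in_bitstrings bits_add_cancel that)
      moreover have "act y u = act x u \<longleftrightarrow> act (x + y) u = u" if "y \<in> bitstrings n"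
        using act_eq_act_iff[OF \<open>x \<in> bitstrings n\<close> that u] by metis
      ultimately show ?thesis
        unfolding f_def L_def mem_Collect_eq by blast
    qed
    then show ?thesis by (intro set_eqI) (simp only: in_coset_iff)
  qed
  have surj: "\<exists>x\<in>bitstrings n. v = act x u" if "v \<in> verts G" for v
    using act_surj[OF assms(1) u that] by blast
  have "bij_betw f (verts G) (cosets n L)"
    unfolding bij_betw_def
  proof
    show "inj_on f (verts G)"
    proof (rule inj_onI)
      fix v w assume "v \<in> verts G" "w \<in> verts G" "f v = f w"
      \<comment> \<open>Any element \<open>x\<close> of the nonempty set \<open>f v\<close> recovers
        \<open>v\<close> as \<open>act x u\<close>.\<close>
      moreover obtain x where "x \<in> f v" using surj[OF \<open>v \<in> verts G\<close>] by (auto simp: f_def)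
      ultimately show "v = w" by (auto simp: f_def)
    qed
    show "f ` verts G = cosets n L"
    proof (intro equalityI subsetI)
      fix C assume "C \<in> f ` verts G"
      then show "C \<in> cosets n L" using surj f_act by (fastforce simp: cosets_def)
    next
      fix C assume "C \<in> cosets n L"
      then obtain x where "x \<in> bitstrings n" "C = f (act x u)"
        using f_act by (auto simp: cosets_def)
      then show "C \<in> f ` verts G" using act_closed[OF u] by auto
    qed
  qed
  moreover have "f (q i v) = translate (f v) (std_basis i)"
    if "i \<in> {1..n}" "v \<in> verts G" for i v
  proof -
    obtain x where x: "x \<in> bitstrings n" "v = act x u" using surj \<open>v \<in> verts G\<close> by blast
    then have "q i v = act (std_basis i + x) u" using that u by (simp add: act_add_std_basis)
    then show ?thesis
      using x that by (simp add: f_act add_in_bitstrings std_basis_in_bitstrings translate_coset)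
  qed
  ultimately have "isomorphic G (cube_quotient n L)" by (rule isomorphic_cube_quotientI)
  then show thesis using that 1 2 by blast
qed

end

section \<open>The involutions of a chromotopology\<close>

text \<open>A 4-cycle may be rotated to start at any of its vertices.\<close>

lemma four_cycle_at:
  assumes "four_cycle G F" "v \<in> \<Union>(ends G ` F)"
  obtains b c d e1 e2 e3 e4 where "distinct [v, b, c, d]" "{e1, e2, e3, e4} = F" "F \<subseteq> edges G"
    "ends G e1 = {v, b}" "ends G e2 = {b, c}" "ends G e3 = {c, d}" "ends G e4 = {d, v}"
proof -
  obtain a b c d e1 e2 e3 e4 where *: "distinct [a, b, c, d]" "F = {e1, e2, e3, e4}" "F \<subseteq> edges G"
    "ends G e1 = {a, b}" "ends G e2 = {b, c}" "ends G e3 = {c, d}" "ends G e4 = {d, a}"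
    using assms(1) unfolding four_cycle_def by (elim exE conjE) (rule that)
  have "v \<in> {a, b} \<union> {b, c} \<union> {c, d} \<union> {d, a}"
    using assms(2) by (simp add: *(2,4-7))
  then consider "v = a" | "v = b" | "v = c" | "v = d" by blast
  then show thesis
  proof cases
    case 1
    then show ?thesis using * that[of b c d e1 e2 e3 e4] by auto
  next
    case 2
    then show ?thesis using * that[of c d a e2 e3 e4 e1] by auto
  next
    case 3
    then show ?thesis using * that[of d a b e3 e4 e1 e2] by auto
  next
    case 4
    then show ?thesis using * that[of a b c e4 e1 e2 e3] by auto
  qed
qed

lemma chromotopology_involutions:
  assumes "chromotopology n G"
  obtains q where "involution_graph n G q"
proof -
  have ecg: "\<And>e. e \<in> edges G \<Longrightarrow> \<exists>u\<in>verts G. \<exists>v\<in>verts G. ends G e = {u, v}"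
    and loopless: "\<And>e v. e \<in> edges G \<Longrightarrow> ends G e \<noteq> {v}"
    and inj: "inj_on (ends G) (edges G)"
    and colors: "\<And>e. e \<in> edges G \<Longrightarrow> color G e \<in> {1..n}"
    and ex1: "\<And>v i. v \<in> verts G \<Longrightarrow> i \<in> {1..n} \<Longrightarrow> \<exists>!e. e \<in> edges G \<and> v \<in> ends G e \<and> color G e = i"
    and cycles: "\<And>i j. i \<in> {1..n} \<Longrightarrow> j \<in> {1..n} \<Longrightarrow> i \<noteq> j \<Longrightarrow>
       disjoint_union_of_four_cycles G {e \<in> edges G. color G e = i \<or> color G e = j}"
    using assms unfolding chromotopology_def edge_colored_graph_def simple_graph_def by auto
  \<comment> \<open>The other end of the edge of color \<open>i\<close> at \<open>v\<close>; the
    uniqueness of that edge makes the choice canonical for vertices and colors in range.\<close>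
  define q where "q i v = (SOME w. \<exists>e\<in>edges G. ends G e = {v, w} \<and> color G e = i)" for i v
  have q_ex: "\<exists>e\<in>edges G. ends G e = {v, q i v} \<and> color G e = i"
    if v: "v \<in> verts G" and i: "i \<in> {1..n}" for v i
  proof -
    obtain e where e: "e \<in> edges G" "v \<in> ends G e" "color G e = i" using ex1[OF v i] by blast
    then obtain w where "ends G e = {v, w}" using ecg[OF e(1)] by (metis e(2) insert_commute insert_iff singletonD)
    then have "\<exists>w. \<exists>e\<in>edges G. ends G e = {v, w} \<and> color G e = i" using e by blast
    then show ?thesis unfolding q_def by (rule someI_ex)
  qed
  have ends_in: "e \<in> edges G \<Longrightarrow> v \<in> ends G e \<Longrightarrow> v \<in> verts G" for e v
    using ecg by fastforce
  have q_eq: "q (color G e) v = w" if e: "e \<in> edges G" "ends G e = {v, w}" for e v w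
  proof -
    have v: "v \<in> verts G" using ends_in e by auto
    obtain e' where e': "e' \<in> edges G" "ends G e' = {v, q (color G e) v}" "color G e' = color G e"
      using q_ex[OF v colors[OF e(1)]] by blast
    have "e' = e" using ex1[OF v colors[OF e(1)]] e e' by auto
    then have "{v, q (color G e) v} = {v, w}" using e e' by simp
    then show ?thesis by (auto simp: doubleton_eq_iff)
  qed
  have "involution_graph n G q"
  proof
    fix i v assume i: "i \<in> {1..n}" and v: "v \<in> verts G"
    obtain e where e: "e \<in> edges G" "ends G e = {v, q i v}" "color G e = i"
      using q_ex[OF v i] by blast
    show "q i v \<in> verts G" using ends_in e by auto
    show "q i (q i v) = v" using q_eq[of e "q i v" v] e by (simp add: insert_commute)
    show "q i v \<noteq> v" using loopless[OF e(1), of v] e by auto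
    fix j assume j: "j \<in> {1..n}"
    obtain e' where e': "e' \<in> edges G" "ends G e' = {v, q j v}" "color G e' = j"
      using q_ex[OF v j] by blast
    show "q i v \<noteq> q j v" if "i \<noteq> j"
      using inj_onD[OF inj, of e e'] e e' that by auto
    show "q i (q j v) = q j (q i v)"
    proof (cases "i = j")
      case False
      let ?F = "{e \<in> edges G. color G e = i \<or> color G e = j}"
      \<comment> \<open>The edge of color \<open>i\<close> at \<open>v\<close> singles out a 4-cycle
        through \<open>v\<close> in the colors \<open>i\<close> and \<open>j\<close>.\<close>
      obtain C where C: "four_cycle G C" "e \<in> C" "C \<subseteq> ?F"
        using cycles[OF i j False] e unfolding disjoint_union_of_four_cycles_def by blast
      have "v \<in> \<Union>(ends G ` C)" using C e by auto
      from C(1) this obtain b c d e1 e2 e3 e4 where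
        cyc: "distinct [v, b, c, d]" "{e1, e2, e3, e4} = C" "C \<subseteq> edges G"
          "ends G e1 = {v, b}" "ends G e2 = {b, c}" "ends G e3 = {c, d}" "ends G e4 = {d, v}"
        by (rule four_cycle_at)
      have E: "e1 \<in> edges G" "e2 \<in> edges G" "e3 \<in> edges G" "e4 \<in> edges G" using cyc(2,3) by auto
      note qs = q_eq[OF E(1) cyc(4)] q_eq[OF E(2) cyc(5)]
        q_eq[OF E(3), of d c, unfolded cyc(6)] q_eq[OF E(4), of v d, unfolded cyc(7)]
        q_eq[OF E(1), of b v, unfolded cyc(4)] q_eq[OF E(4) cyc(7)]
      \<comment> \<open>Adjacent edges of equal color would lead from their common vertex to equal
        neighbors. With only two colors, opposite edges then agree in color, so the two routes from
        \<open>v\<close> to \<open>c\<close> apply \<open>q i\<close> and \<open>q j\<close> in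
        opposite orders.\<close>
      have "color G e1 \<noteq> color G e2" "color G e1 \<noteq> color G e4" "color G e3 \<noteq> color G e4"
        using qs cyc(1) by (auto simp: insert_commute)
      moreover have "color G e1 \<in> {i, j}" "color G e2 \<in> {i, j}" "color G e3 \<in> {i, j}" "color G e4 \<in> {i, j}"
        using C(3) cyc(2) by auto
      ultimately show ?thesis using qs by (auto simp: insert_commute)
    qed simp
  next
    show "bij_betw (\<lambda>e. (ends G e, color G e)) (edges G)
      {({v, q i v}, i) | v i. v \<in> verts G \<and> i \<in> {1..n}}"
      unfolding bij_betw_def
    proof
      show "inj_on (\<lambda>e. (ends G e, color G e)) (edges G)"
        using inj by (auto simp: inj_on_def)
      show "(\<lambda>e. (ends G e, color G e)) ` edges G = {({v, q i v}, i) | v i. v \<in> verts G \<and> i \<in> {1..n}}"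
      proof (intro equalityI subsetI)
        fix p assume "p \<in> (\<lambda>e. (ends G e, color G e)) ` edges G"
        then obtain e where e: "e \<in> edges G" "p = (ends G e, color G e)" by blast
        then obtain v w where "v \<in> verts G" "ends G e = {v, w}" using ecg by blast
        then show "p \<in> {({v, q i v}, i) | v i. v \<in> verts G \<and> i \<in> {1..n}}"
          using e q_eq colors by blast
      next
        fix p assume "p \<in> {({v, q i v}, i) | v i. v \<in> verts G \<and> i \<in> {1..n}}"
        then obtain v i where vi: "p = ({v, q i v}, i)" "v \<in> verts G" "i \<in> {1..n}" by blast
        then show "p \<in> (\<lambda>e. (ends G e, color G e)) ` edges G"
          using q_ex[OF vi(2,3)] by force
      qed
    qed
  qed
  then show thesis by (rule that)
qed

section \<open>Quotients of the cube by even codes\<close>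

lemma chromotopology_if_isomorphic_cube_quotient:
  assumes G: "edge_colored_graph G" and L: "even_code n L" "\<forall>x\<in>L. weight x \<noteq> 2"
    and "isomorphic G (cube_quotient n L)"
  shows "chromotopology n G"
proof -
  have code: "code n L" and even: "\<And>x. x \<in> L \<Longrightarrow> even (weight x)"
    using L(1) by (auto simp: even_code_def)
  have L_sub: "L \<subseteq> bitstrings n" using code by (simp add: code_def)
  \<comment> \<open>An edge of \<open>cube_quotient\<close> is the pair of its endpoint set and
    color, so \<open>f\<close> determines the edge map \<open>g\<close>.\<close>
  obtain f g where f: "bij_betw f (verts G) (cosets n L)"
    and g: "bij_betw g (edges G) (edges (cube_quotient n L))"
    and fg: "\<And>e. e \<in> edges G \<Longrightarrow> g e = (f ` ends G e, color G e)"
    using assms(4) unfolding isomorphic_def by (auto simp: cube_quotient_def prod_eq_iff)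
  have f_in: "f v \<in> cosets n L" if "v \<in> verts G" for v
    using bij_betwE[OF f] that by blast
  have f_eq: "v = w" if "f v = f w" "v \<in> verts G" "w \<in> verts G" for v w
    using bij_betw_imp_inj_on[OF f] that by (auto dest: inj_onD)
  \<comment> \<open>Translation by \<open>std_basis i\<close>, transported to \<open>G\<close> along
    \<open>f\<close>.\<close>
  define q where "q i v = inv_into (verts G) f (translate (f v) (std_basis i))" for i v
  have q: "q i v \<in> verts G" "f (q i v) = translate (f v) (std_basis i)"
    if "i \<in> {1..n}" "v \<in> verts G" for i v
  proof -
    have "translate (f v) (std_basis i) \<in> f ` verts G"
      using translate_in_cosets[OF f_in std_basis_in_bitstrings] that bij_betw_imp_surj_on[OF f] by simp
    then show "q i v \<in> verts G" "f (q i v) = translate (f v) (std_basis i)"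
      unfolding q_def by (rule inv_into_into, rule f_inv_into_f)
  qed
  interpret involution_graph n G q
  proof
    fix i v assume i: "i \<in> {1..n}" and v: "v \<in> verts G"
    show "q i v \<in> verts G" using q i v by simp
    show "q i (q i v) = v"
      by (rule f_eq) (use q i v in \<open>simp_all add: translate_translate\<close>)
    \<comment> \<open>Evenness excludes words of weight 1, hence loops.\<close>
    have "std_basis i \<notin> L" using even[of "std_basis i"] by (auto simp: weight_std_basis)
    then have "translate (f v) (std_basis i) \<noteq> translate (f v) 0"
      by (simp only: translate_eq_translate_iff[OF code f_in[OF v]] add_0_right not_False_eq_True)
    then show "q i v \<noteq> v" using q[OF i v] by (metis translate_zero)
    fix j assume j: "j \<in> {1..n}"
    show "q i (q j v) = q j (q i v)"
      by (rule f_eq) (use q i j v in \<open>simp_all add: translate_translate add.commute\<close>)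
    assume "i \<noteq> j"
    \<comment> \<open>Excluding weight 2 keeps the neighbors in different colors apart.\<close>
    then have "std_basis i + std_basis j \<notin> L" using L(2) weight_two_std_basis by blast
    then show "q i v \<noteq> q j v"
      using q i j v translate_eq_translate_iff[OF code f_in[OF v]] by metis
  next
    show "bij_betw (\<lambda>e. (ends G e, color G e)) (edges G)
      {({v, q i v}, i) | v i. v \<in> verts G \<and> i \<in> {1..n}}"
      unfolding bij_betw_def
    proof
      show "inj_on (\<lambda>e. (ends G e, color G e)) (edges G)"
        using bij_betw_imp_inj_on[OF g] fg by (auto simp: inj_on_def)
      have ends_sub: "ends G e \<subseteq> verts G" if "e \<in> edges G" for e
        using G that by (fastforce simp: edge_colored_graph_def)
      \<comment> \<open>Injectivity of \<open>f\<close> recovers an endpoint set from its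
        image.\<close>
      have ends_eq: "ends G e = {v, q i v}"
        if "e \<in> edges G" "v \<in> verts G" "i \<in> {1..n}" "f ` ends G e = {f v, translate (f v) (std_basis i)}"
        for e v i
      proof -
        have "f ` ends G e = f ` {v, q i v}" using that q by simp
        then show ?thesis
          using inj_on_image_eq_iff[OF bij_betw_imp_inj_on[OF f]] ends_sub that q by (metis empty_subsetI insert_subset)
      qed
      show "(\<lambda>e. (ends G e, color G e)) ` edges G = {({v, q i v}, i) | v i. v \<in> verts G \<and> i \<in> {1..n}}"
      proof (intro equalityI subsetI)
        fix p assume "p \<in> (\<lambda>e. (ends G e, color G e)) ` edges G"
        then obtain e where e: "e \<in> edges G" "p = (ends G e, color G e)" by blast
        have "g e \<in> edges (cube_quotient n L)" using bij_betwE[OF g] e by blast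
        then obtain C i where C: "C \<in> cosets n L" "i \<in> {1..n}" "g e = ({C, translate C (std_basis i)}, i)"
          by (auto simp: cube_quotient_def)
        moreover obtain v where "v \<in> verts G" "C = f v"
          using C bij_betw_imp_surj_on[OF f] by blast
        ultimately show "p \<in> {({v, q i v}, i) | v i. v \<in> verts G \<and> i \<in> {1..n}}"
          using e fg[OF e(1)] ends_eq[OF e(1)] by auto
      next
        fix p assume "p \<in> {({v, q i v}, i) | v i. v \<in> verts G \<and> i \<in> {1..n}}"
        then obtain v i where vi: "p = ({v, q i v}, i)" "v \<in> verts G" "i \<in> {1..n}" by blast
        then have "({f v, translate (f v) (std_basis i)}, i) \<in> edges (cube_quotient n L)"
          using f_in by (auto simp: cube_quotient_def)
        then obtain e where e: "e \<in> edges G" "g e = ({f v, translate (f v) (std_basis i)}, i)"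
          using bij_betw_imp_surj_on[OF g] by (metis imageE)
        then have "p = (ends G e, color G e)"
          using fg[OF e(1)] ends_eq[OF e(1) vi(2,3)] vi(1) by simp
        then show "p \<in> (\<lambda>e. (ends G e, color G e)) ` edges G" using e by blast
      qed
    qed
  qed
  have f_act: "f (act x v) = translate (f v) x" if "x \<in> bitstrings n" "v \<in> verts G" for x v
    using that
  proof (induction rule: bitstrings_induct)
    case (add x i)
    then show ?case
      by (simp add: act_add_std_basis q act_closed translate_translate add.commute[of x])
  qed simp
  \<comment> \<open>Writing \<open>x\<close> as a sum of basis vectors spells out a walk from
    \<open>v\<close> to \<open>act x v\<close>.\<close>
  have reach: "(v, act x v) \<in> {(x, y). \<exists>e\<in>edges G. ends G e = {x, y}}\<^sup>*"
    if "x \<in> bitstrings n" "v \<in> verts G" for x v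
    using that
  proof (induction rule: bitstrings_induct)
    case (add x i)
    then have "act x v \<in> verts G" by (simp add: act_closed)
    then have "(act x v, q i (act x v)) \<in> {(x, y). \<exists>e\<in>edges G. ends G e = {x, y}}"
      using edge[of "act x v" i] add(2) by auto
    then show ?case
      using add by (simp add: act_add_std_basis rtrancl.rtrancl_into_rtrancl)
  qed simp
  have "connected_graph G"
    unfolding connected_graph_def
  proof (intro conjI ballI)
    have "cosets n L \<noteq> {}" using zero_in_bitstrings[of n] by (metis cosets_def empty_iff image_is_empty)
    then show "verts G \<noteq> {}" using bij_betw_imp_surj_on[OF f] by blast
    fix u v assume uv: "u \<in> verts G" "v \<in> verts G"
    obtain x y where xy: "x \<in> bitstrings n" "f u = (+) x ` L" "y \<in> bitstrings n" "f v = (+) y ` L"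
      using f_in[OF uv(1)] f_in[OF uv(2)] unfolding cosets_def by (elim imageE) (rule that)
    \<comment> \<open>Translation by \<open>x + y\<close> takes the coset of \<open>x\<close> to the
      coset of \<open>y\<close>.\<close>
    have "f (act (x + y) u) = f v"
      using f_act[OF add_in_bitstrings[OF xy(1,3)] uv(1)] xy
      by (simp add: translate_coset add.commute[of "x + y" x])
    then have "act (x + y) u = v" using f_eq act_closed uv by blast
    then show "(u, v) \<in> {(x, y). \<exists>e\<in>edges G. ends G e = {x, y}}\<^sup>*"
      using reach[OF add_in_bitstrings[OF xy(1,3)] uv(1)] by simp
  qed
  moreover have "finite (verts G)"
    using bij_betw_finite[OF f] finite_bitstrings by (simp add: cosets_def)
  moreover have "bipartite_graph G"
  proof -
    \<comment> \<open>The common parity of the bitstrings in the coset \<open>f v\<close>; it exists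
      because every word of \<open>L\<close> has parity 0.\<close>
    define par where "par v = (THE b. \<forall>x\<in>f v. parity n x = b)" for v
    have par: "par v = parity n x" if "v \<in> verts G" "f v = (+) x ` L" for v x
      unfolding par_def
    proof (rule the_equality)
      have "parity n z = 0" if "z \<in> L" for z
        using that even even_weight_iff_parity L_sub by blast
      then show *: "\<forall>y\<in>f v. parity n y = parity n x" using that by auto
      fix b assume "\<forall>y\<in>f v. parity n y = b"
      moreover have "x \<in> f v" using that code_zero[OF code] by (simp add: in_coset_iff)
      ultimately show "b = parity n x" by auto
    qed
    have par_q: "par (q i v) = 1 + par v" if "i \<in> {1..n}" "v \<in> verts G" for i v
    proof -
      obtain x where x: "f v = (+) x ` L" using f_in[OF \<open>v \<in> verts G\<close>] by (auto simp: cosets_def)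
      then have "f (q i v) = (+) (std_basis i + x) ` L" using q that by (simp add: translate_coset)
      then show ?thesis using par[OF _ x] par[of "q i v"] that q by simp
    qed
    show ?thesis
      unfolding bipartite_graph_def
    proof (intro exI conjI ballI)
      show "{v \<in> verts G. par v = 0} \<union> {v \<in> verts G. par v = 1} = verts G" by auto
      show "{v \<in> verts G. par v = 0} \<inter> {v \<in> verts G. par v = 1} = {}" by auto
      fix e assume "e \<in> edges G"
      then obtain v where v: "v \<in> verts G" "color G e \<in> {1..n}" "ends G e = {v, q (color G e) v}"
        by (rule edge_cases)
      note pq = par_q[OF v(2,1)] q(1)[OF v(2,1)]
      show "\<exists>a\<in>{v \<in> verts G. par v = 0}. \<exists>b\<in>{v \<in> verts G. par v = 1}. ends G e = {a, b}"
      proof (cases "par v = 0")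
        case True
        then show ?thesis using v pq by auto
      next
        case False
        then have "par (q (color G e) v) = 0" "par v = 1" using pq by auto
        then show ?thesis using v pq(2) by (metis (mono_tags, lifting) insert_commute mem_Collect_eq)
      qed
    qed
  qed
  ultimately show ?thesis by (intro chromotopologyI)
qed

theorem mainTheorem3:
  fixes G :: "('v, 'e) cgraph" and n :: nat
  assumes "edge_colored_graph G"
  shows "chromotopology n G \<longleftrightarrow>
    (\<exists>L. even_code n L \<and> (\<forall>x\<in>L. weight x \<noteq> 2) \<and> isomorphic G (cube_quotient n L))"
proof
  assume G: "chromotopology n G"
  then obtain q where "involution_graph n G q" by (rule chromotopology_involutions)
  moreover have "connected_graph G" "bipartite_graph G"
    using G by (auto simp: chromotopology_def)
  ultimately show "\<exists>L. even_code n L \<and> (\<forall>x\<in>L. weight x \<noteq> 2) \<and> isomorphic G (cube_quotient n L)"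
    by (meson involution_graph.isomorphic_cube_quotient)
next
  assume "\<exists>L. even_code n L \<and> (\<forall>x\<in>L. weight x \<noteq> 2) \<and> isomorphic G (cube_quotient n L)"
  then show "chromotopology n G"
    using chromotopology_if_isomorphic_cube_quotient[OF assms] by blast
qed

end
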